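(* For every positive integer $d$, the category $\mathbf{OI}_d$, normed by $\nu(x)=\#x$, is $\mathrm{O}$-lingual and Gröbner.
   Context: $\mathbf{OI}_d$ is the category whose objects are totally ordered finite sets; a morphism $S\to T$ is a pair $(f,g)$ with $f\colon S\to T$ an order-preserving injection and $g\colon T\setminus f(S)\to\{1,\dots,d\}$ an arbitrary function. The composite of $(f,g)\colon S\to T$ and $(f',g')\colon T\to U$ is $(f'f,g'')$ where $g''=g'$ on $U\setminus f'(T)$ and $g''(f'(t))=g(t)$ for $t\in T\setminus f(S)$. This category is directed (every self-map is the identity). For a directed category $\mathcal{C}$ and object $x$, $|\mathcal{C}_x|$ is the set of isomorphism classes of morphisms $x\to y$ ($y$ varying) in the category of morphisms out of $x$, partially ordered by $f\le g$ iff $g=hf$ for some $h$. A directed category $\mathcal{C}$ is Gröbner if for every $x$: (G1) $|\mathcal{C}_x|$ admits an admissible order, i.e. a well-order $\preceq$ such that $f\prec f'$ in $\mathrm{Hom}(x,y)$ and $g\in\mathrm{Hom}(y,z)$ imply $gf\prec gf'$ (equivalently: one can choose well-orders on all sets $\mathrm{Hom}(x,y)$ such that all postcomposition maps are strictly order-preserving); (G2) the poset $|\mathcal{C}_x|$ is noetherian, i.e. every infinite sequence $x_1,x_2,\dots$ has $i<j$ with $x_i\le x_j$. For a finite alphabet $\Sigma$, $\Sigma^\star$ is the set of finite words, and a language on $\Sigma$ is a subset of $\Sigma^\star$. The set of ordered languages on $\Sigma$ is the smallest set of languages on $\Sigma$ that contains the singleton languages $\{c\}$ ($c\in\Sigma$)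 and the languages $\Pi^\star$ for $\Pi\subseteq\Sigma$, and is closed under finite union (including the empty union) and concatenation. A directed category with norm $\nu\colon|\mathcal{C}|\to\mathbf{N}$ ($|\mathcal{C}|$ the isomorphism classes of objects) is $\mathrm{O}$-lingual if for every object $x$ there are a finite alphabet $\Sigma$ and an injection $i\colon|\mathcal{C}_x|\to\Sigma^\star$ such that for every $f\colon x\to y$ the word $i(f)$ has length $\nu(y)$, and for every ideal (upward closed subset) $J$ of $|\mathcal{C}_x|$ the language $i(J)$ is ordered. *)

theory Defs
  imports "HOL-Library.FuncSet"
begin

text \<open>
  Arrows are not required to determine their source and target, so composition takes the three
  objects involved as arguments: for \<open>f \<in> Hom C x y\<close> and \<open>g \<in> Hom C y z\<close>, the composite
  \<open>g f\<close> is \<open>Comp C x y z g f\<close>.  Only objects in \<open>Obj C\<close> are relevant.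
\<close>

record ('o, 'm) category =
  Obj :: "'o set"
  Hom :: "'o \<Rightarrow> 'o \<Rightarrow> 'm set"
  Ident :: "'o \<Rightarrow> 'm"
  Comp :: "'o \<Rightarrow> 'o \<Rightarrow> 'o \<Rightarrow> 'm \<Rightarrow> 'm \<Rightarrow> 'm"

definition is_category :: "('o, 'm) category \<Rightarrow> bool" where
  "is_category C \<longleftrightarrow>
     (\<forall>x\<in>Obj C. Ident C x \<in> Hom C x x) \<and>
     (\<forall>x\<in>Obj C. \<forall>y\<in>Obj C. \<forall>z\<in>Obj C. \<forall>f\<in>Hom C x y. \<forall>g\<in>Hom C y z.
        Comp C x y z g f \<in> Hom C x z) \<and>
     (\<forall>x\<in>Obj C. \<forall>y\<in>Obj C. \<forall>f\<in>Hom C x y.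
        Comp C x x y f (Ident C x) = f \<and> Comp C x y y (Ident C y) f = f) \<and>
     (\<forall>w\<in>Obj C. \<forall>x\<in>Obj C. \<forall>y\<in>Obj C. \<forall>z\<in>Obj C.
        \<forall>f\<in>Hom C w x. \<forall>g\<in>Hom C x y. \<forall>h\<in>Hom C y z.
          Comp C w x z (Comp C x y z h g) f = Comp C w y z h (Comp C w x y g f))"

definition directed_category :: "('o, 'm) category \<Rightarrow> bool" where
  "directed_category C \<longleftrightarrow> is_category C \<and> (\<forall>x\<in>Obj C. \<forall>f\<in>Hom C x x. f = Ident C x)"

definition isomorphic :: "('o, 'm) category \<Rightarrow> 'o \<Rightarrow> 'o \<Rightarrow> bool" where
  "isomorphic C x y \<longleftrightarrow>
     (\<exists>h\<in>Hom C x y. \<exists>k\<in>Hom C y x. Comp C x y x k h = Ident C x \<and> Comp C y x y h k = Ident C y)"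

definition iso_rel :: "('o, 'm) category \<Rightarrow> 'o rel" where
  "iso_rel C = {(x, y). x \<in> Obj C \<and> y \<in> Obj C \<and> isomorphic C x y}"

definition iso_classes :: "('o, 'm) category \<Rightarrow> 'o set set" where
  "iso_classes C = Obj C // iso_rel C"

text \<open>A norm on the isomorphism classes of objects is an isomorphism-invariant function on objects.\<close>

definition category_norm :: "('o, 'm) category \<Rightarrow> ('o \<Rightarrow> nat) \<Rightarrow> bool" where
  "category_norm C \<nu> \<longleftrightarrow> (\<forall>x\<in>Obj C. \<forall>y\<in>Obj C. isomorphic C x y \<longrightarrow> \<nu> x = \<nu> y)"

text \<open>The object \<open>(y, f)\<close> of the coslice category stands for the morphism \<open>f : x \<rightarrow> y\<close>.\<close>

definition coslice :: "('o, 'm) category \<Rightarrow> 'o \<Rightarrow> ('o \<times> 'm, 'm) category" where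
  "coslice C x =
     \<lparr>Obj = (SIGMA y : Obj C. Hom C x y),
      Hom = (\<lambda>(y, f) (z, g). {h \<in> Hom C y z. Comp C x y z h f = g}),
      Ident = (\<lambda>(y, f). Ident C y),
      Comp = (\<lambda>a b c. Comp C (fst a) (fst b) (fst c))\<rparr>"

abbreviation morphism_classes :: "('o, 'm) category \<Rightarrow> 'o \<Rightarrow> ('o \<times> 'm) set set" where
  "morphism_classes C x \<equiv> iso_classes (coslice C x)"

definition morphism_class :: "('o, 'm) category \<Rightarrow> 'o \<Rightarrow> 'o \<Rightarrow> 'm \<Rightarrow> ('o \<times> 'm) set" where
  "morphism_class C x y f = iso_rel (coslice C x) `` {(y, f)}"

definition morphism_le ::
  "('o, 'm) category \<Rightarrow> 'o \<Rightarrow> ('o \<times> 'm) set \<Rightarrow> ('o \<times> 'm) set \<Rightarrow> bool" where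
  "morphism_le C x P Q \<longleftrightarrow>
     (\<exists>(y, f)\<in>P. \<exists>(z, g)\<in>Q. \<exists>h\<in>Hom C y z. g = Comp C x y z h f)"

definition morphism_ideal :: "('o, 'm) category \<Rightarrow> 'o \<Rightarrow> ('o \<times> 'm) set set \<Rightarrow> bool" where
  "morphism_ideal C x J \<longleftrightarrow>
     J \<subseteq> morphism_classes C x \<and>
     (\<forall>P\<in>J. \<forall>Q\<in>morphism_classes C x. morphism_le C x P Q \<longrightarrow> Q \<in> J)"

text \<open>
  \<^const>\<open>well_order_on\<close> refers to the reflexive order; its strict part is \<open>r - Id\<close>.
\<close>

definition admissible_order :: "('o, 'm) category \<Rightarrow> 'o \<Rightarrow> ('o \<times> 'm) set rel \<Rightarrow> bool" where
  "admissible_order C x r \<longleftrightarrow>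
     well_order_on (morphism_classes C x) r \<and>
     (\<forall>y\<in>Obj C. \<forall>z\<in>Obj C. \<forall>f\<in>Hom C x y. \<forall>f'\<in>Hom C x y. \<forall>g\<in>Hom C y z.
        (morphism_class C x y f, morphism_class C x y f') \<in> r - Id \<longrightarrow>
        (morphism_class C x z (Comp C x y z g f), morphism_class C x z (Comp C x y z g f')) \<in> r - Id)"

definition noetherian_morphisms :: "('o, 'm) category \<Rightarrow> 'o \<Rightarrow> bool" where
  "noetherian_morphisms C x \<longleftrightarrow>
     (\<forall>s :: nat \<Rightarrow> ('o \<times> 'm) set. (\<forall>n. s n \<in> morphism_classes C x) \<longrightarrow>
        (\<exists>i j. i < j \<and> morphism_le C x (s i) (s j)))"

definition groebner :: "('o, 'm) category \<Rightarrow> bool" where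
  "groebner C \<longleftrightarrow>
     directed_category C \<and>
     (\<forall>x\<in>Obj C. (\<exists>r. admissible_order C x r) \<and> noetherian_morphisms C x)"

inductive_set ordered_languages :: "'s set \<Rightarrow> 's list set set" for \<Sigma> :: "'s set" where
  letter: "c \<in> \<Sigma> \<Longrightarrow> {[c]} \<in> ordered_languages \<Sigma>"
| star: "\<Gamma> \<subseteq> \<Sigma> \<Longrightarrow> lists \<Gamma> \<in> ordered_languages \<Sigma>"
| union: "finite F \<Longrightarrow> (\<And>L. L \<in> F \<Longrightarrow> L \<in> ordered_languages \<Sigma>) \<Longrightarrow> \<Union>F \<in> ordered_languages \<Sigma>"
| concat: "K \<in> ordered_languages \<Sigma> \<Longrightarrow> L \<in> ordered_languages \<Sigma> \<Longrightarrow>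
    {u @ v | u v. u \<in> K \<and> v \<in> L} \<in> ordered_languages \<Sigma>"

text \<open>
  HOL cannot quantify existentially over types, so alphabets range over the finite sets of natural
  numbers; up to renaming of letters this covers every finite alphabet.
\<close>

definition o_lingual :: "('o, 'm) category \<Rightarrow> ('o \<Rightarrow> nat) \<Rightarrow> bool" where
  "o_lingual C \<nu> \<longleftrightarrow>
     directed_category C \<and> category_norm C \<nu> \<and>
     (\<forall>x\<in>Obj C. \<exists>(\<Sigma> :: nat set) (i :: ('o \<times> 'm) set \<Rightarrow> nat list).
        finite \<Sigma> \<and>
        i ` morphism_classes C x \<subseteq> lists \<Sigma> \<and>
        inj_on i (morphism_classes C x) \<and>
        (\<forall>y\<in>Obj C. \<forall>f\<in>Hom C x y. length (i (morphism_class C x y f)) = \<nu> y) \<and>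
        (\<forall>J. morphism_ideal C x J \<longrightarrow> i ` J \<in> ordered_languages \<Sigma>))"

text \<open>
  An object \<open>(A, r)\<close> is a finite set together with a (reflexive) linear order on it.  Functions
  between sets are extensional (\<^const>\<open>PiE\<close>), so that equal morphisms are equal pairs.
  For an infinite type \<open>'a\<close> every totally ordered finite set is isomorphic to an object.
\<close>

definition OI :: "nat \<Rightarrow> ('a set \<times> 'a rel, ('a \<Rightarrow> 'a) \<times> ('a \<Rightarrow> nat)) category" where
  "OI d =
     \<lparr>Obj = {(A, r). finite A \<and> linear_order_on A r},
      Hom = (\<lambda>(S, r) (T, r'). {(f, g).
        f \<in> S \<rightarrow>\<^sub>E T \<and> inj_on f S \<and> (\<forall>s\<in>S. \<forall>t\<in>S. (s, t) \<in> r \<longrightarrow> (f s, f t) \<in> r') \<and>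
        g \<in> (T - f ` S) \<rightarrow>\<^sub>E {1..d}}),
      Ident = (\<lambda>(S, r). (\<lambda>s\<in>S. s, \<lambda>s\<in>{}. undefined)),
      Comp = (\<lambda>(S, _) (T, _) (U, _) (f', g') (f, g).
        (compose S f' f,
         \<lambda>u\<in>U - f' ` f ` S. if u \<in> f' ` T then g (inv_into T f' u) else g' u))\<rparr>"

end

theory Submission
  imports Defs "HOL-Library.Sublist" "HOL-Library.Infinite_Set"
begin

text \<open>
  Encode a morphism \<open>(f, g)\<close> from \<open>S\<close> to \<open>T\<close> as the word that lists, along the order of \<open>T\<close>, the
  letter \<open>0\<close> at the points of \<open>f(S)\<close> and the value of \<open>g\<close> elsewhere.  All words of morphisms out of
  \<open>S\<close> contain the letter \<open>0\<close> exactly \<open>#S\<close> times, so one morphism factors through another iff its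
  word contains the other word as a (scattered) subsequence, and morphisms are isomorphic iff their
  words agree.  Noetherianity is then Higman's lemma, and postcomposition inserts the same letters
  at the same positions in all words, so the length-lexicographic order is admissible.  By
  Higman's lemma an ideal has finitely many minimal words \<open>w\<^sub>1\<dots>w\<^sub>n\<close>, and the ideal
  generated by such a word is the ordered language \<open>\<Gamma>\<^sup>\<star>w\<^sub>1\<Gamma>\<^sup>\<star>\<dots>w\<^sub>n\<Gamma>\<^sup>\<star>\<close> with \<open>\<Gamma> = {1,\<dots>,d}\<close>.
\<close>

section \<open>Higman's lemma\<close>

definition bad :: "'a list set \<Rightarrow> (nat \<Rightarrow> 'a list) \<Rightarrow> bool" where
  "bad A s \<longleftrightarrow> range s \<subseteq> A \<and> (\<forall>i j. i < j \<longrightarrow> \<not> subseq (s i) (s j))"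

text \<open>Nash-Williams: choose each term of minimal length among the bad continuations.\<close>

lemma minimal_bad_sequence:
  assumes "bad A s0"
  obtains s where "bad A s"
    "\<And>t n. bad A t \<Longrightarrow> (\<And>i. i < n \<Longrightarrow> t i = s i) \<Longrightarrow> length (s n) \<le> length (t n)"
proof -
  \<comment> \<open>\<open>P n s\<close>: the terms of \<open>s\<close> with index below
    \<open>n\<close> are already chosen greedily. The step from \<open>n\<close> to
    \<open>Suc n\<close> may change \<open>s\<close> only from index \<open>n\<close> on.\<close>
  define P where "P n s \<longleftrightarrow> bad A s \<and>
    (\<forall>t k. k < n \<longrightarrow> bad A t \<longrightarrow> (\<forall>i<k. t i = s i) \<longrightarrow> length (s k) \<le> length (t k))" for n s
  have step: "\<exists>t. P (Suc n) t \<and> (\<forall>i<n. t i = s i)" if s: "P n s" for n s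
  proof -
    define Q where "Q t \<longleftrightarrow> bad A t \<and> (\<forall>i<n. t i = s i)" for t
    have "Q s"
      using s by (simp add: P_def Q_def)
    then obtain t where t: "Q t" "\<And>u. Q u \<Longrightarrow> length (t n) \<le> length (u n)"
      using ex_has_least_nat[of Q s "\<lambda>t. length (t n)"] by blast
    have "length (t k) \<le> length (u k)" if "k < Suc n" "bad A u" "\<forall>i<k. u i = t i" for u k
    proof (cases "k = n")
      case True
      then show ?thesis
        using that t by (simp add: Q_def)
    next
      case False
      then show ?thesis
        using that t(1) s by (simp add: P_def Q_def)
    qed
    then show ?thesis
      using t(1) by (auto simp: P_def Q_def)
  qed
  have "P 0 s0"
    using assms by (simp add: P_def)
  then obtain S where S: "\<And>n. P n (S n)" "\<And>n i. i < n \<Longrightarrow> S (Suc n) i = S n i"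
    using dependent_nat_choice[of P "\<lambda>n s t. \<forall>i<n. t i = s i"] step by metis
  \<comment> \<open>Term \<open>n\<close> is frozen from stage \<open>Suc n\<close> on, not yet at
    stage \<open>n\<close>, so the diagonal reads it off there. Any pair \<open>i < j\<close> of
    diagonal terms then lies in the single bad sequence \<open>S (Suc j)\<close>.\<close>
  define s where "s n = S (Suc n) n" for n
  have stable: "S m i = s i" if "i < m" for i m
    using that unfolding s_def
    by (induction m) (auto simp: less_Suc_eq S(2))
  have "bad A s"
    unfolding bad_def
  proof (intro conjI allI impI)
    have "S m k \<in> A" for m k
      using S(1)[of m] unfolding P_def bad_def by auto
    then show "range s \<subseteq> A"
      unfolding s_def by auto
    fix i j :: nat assume "i < j"
    then show "\<not> subseq (s i) (s j)"
      using S(1)[of "Suc j"] stable[of i "Suc j"] stable[of j "Suc j"]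
      unfolding P_def bad_def by (metis less_Suc_eq)
  qed
  moreover have "length (s n) \<le> length (t n)" if "bad A t" "\<And>i. i < n \<Longrightarrow> t i = s i" for t n
    using S(1)[of "Suc n"] that stable unfolding P_def by (metis lessI less_SucI)
  ultimately show thesis
    using that by blast
qed

text \<open>In a minimal bad sequence no word is empty, and by the pigeonhole principle infinitely
  many words share their first letter. Deleting this letter from those words, and splicing the
  results after the terms that precede the first of them, gives a bad sequence that is shorter at
  the splice, contrary to minimality.\<close>

lemma higman:
  fixes s :: "nat \<Rightarrow> 'a list"
  assumes "finite \<Sigma>" "\<And>n. s n \<in> lists \<Sigma>"
  shows "\<exists>i j. i < j \<and> subseq (s i) (s j)"
proof (rule ccontr)
  assume "\<not> ?thesis"
  then have "bad (lists \<Sigma>) s"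
    using assms(2) by (auto simp: bad_def)
  then obtain m where m: "bad (lists \<Sigma>) m"
    and min: "\<And>t n. bad (lists \<Sigma>) t \<Longrightarrow> (\<And>i. i < n \<Longrightarrow> t i = m i) \<Longrightarrow> length (m n) \<le> length (t n)"
    using minimal_bad_sequence by metis
  have m_lists: "m n \<in> lists \<Sigma>" for n
    using m unfolding bad_def by auto
  have m_bad: "\<not> subseq (m i) (m j)" if "i < j" for i j
    using m that unfolding bad_def by auto
  have ne: "m n \<noteq> []" for n
    using m_bad[of n "Suc n"] by auto
  have "hd (m n) \<in> \<Sigma>" for n
    using m_lists[of n] ne[of n] by (cases "m n") auto
  then have "range (\<lambda>n. hd (m n)) \<subseteq> \<Sigma>"
    by auto
  then have "finite (range (\<lambda>n. hd (m n)))"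
    using assms(1) by (rule finite_subset)
  then obtain n0 where n0: "infinite {n. hd (m n) = hd (m n0)}"
    using pigeonhole_infinite[of "UNIV :: nat set" "\<lambda>n. hd (m n)"] by auto
  define \<phi> where "\<phi> = enumerate {n. hd (m n) = hd (m n0)}"
  have \<phi>_mono: "\<phi> i < \<phi> j" if "i < j" for i j
    using strict_mono_enumerate[OF n0] that unfolding \<phi>_def strict_mono_def by blast
  have m_\<phi>: "m (\<phi> n) = hd (m n0) # tl (m (\<phi> n))" for n
  proof -
    have "hd (m (\<phi> n)) = hd (m n0)"
      using enumerate_in_set[OF n0, of n] unfolding \<phi>_def by simp
    then show ?thesis
      using list.collapse[OF ne[of "\<phi> n"]] by simp
  qed
  \<comment> \<open>The splice: index \<open>\<phi> 0\<close> receives the tail of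
    \<open>m (\<phi> 0)\<close>, so this is where minimality will be contradicted.\<close>
  define t where "t n = (if n < \<phi> 0 then m n else tl (m (\<phi> (n - \<phi> 0))))" for n
  have tl_sub: "subseq (tl w) w" for w :: "'a list"
    by (cases w) auto
  have "bad (lists \<Sigma>) t"
    unfolding bad_def
  proof (intro conjI allI impI)
    have "tl (m n) \<in> lists \<Sigma>" for n
      using m_lists[of n] by (cases "m n") auto
    then show "range t \<subseteq> lists \<Sigma>"
      using m_lists by (auto simp: t_def)
    fix i j :: nat assume ij: "i < j"
    show "\<not> subseq (t i) (t j)"
    proof
      assume sub: "subseq (t i) (t j)"
      consider "j < \<phi> 0" | "i < \<phi> 0" "\<phi> 0 \<le> j" | "\<phi> 0 \<le> i"
        by linarith
      then show False
      proof cases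
        case 1
        then show False
          using sub ij m_bad by (simp add: t_def)
      next
        case 2
        \<comment> \<open>An old term embedded in a tail is embedded in the full word
          \<open>m (\<phi> (j - \<phi> 0))\<close>, whose index still exceeds
          \<open>i\<close>.\<close>
        have "\<phi> 0 \<le> \<phi> (j - \<phi> 0)"
          using \<phi>_mono[of 0 "j - \<phi> 0"] by (cases "j - \<phi> 0 = 0") auto
        moreover have "subseq (m i) (m (\<phi> (j - \<phi> 0)))"
          using sub 2 subseq_order.trans[OF _ tl_sub] by (simp add: t_def)
        ultimately show False
          using m_bad 2 by (meson less_le_trans)
      next
        case 3
        then have "subseq (tl (m (\<phi> (i - \<phi> 0)))) (tl (m (\<phi> (j - \<phi> 0))))"
          using sub ij by (simp add: t_def)
        then have "subseq (hd (m n0) # tl (m (\<phi> (i - \<phi> 0)))) (hd (m n0) # tl (m (\<phi> (j - \<phi> 0))))"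
          by (rule subseq_Cons2)
        then have "subseq (m (\<phi> (i - \<phi> 0))) (m (\<phi> (j - \<phi> 0)))"
          by (simp only: m_\<phi>[symmetric])
        moreover have "\<phi> (i - \<phi> 0) < \<phi> (j - \<phi> 0)"
          using 3 ij \<phi>_mono by simp
        ultimately show False
          using m_bad by blast
      qed
    qed
  qed
  moreover have "t i = m i" if "i < \<phi> 0" for i
    using that by (simp add: t_def)
  ultimately have "length (m (\<phi> 0)) \<le> length (t (\<phi> 0))"
    by (rule min)
  moreover have "t (\<phi> 0) = tl (m (\<phi> 0))"
    by (simp add: t_def)
  ultimately have "length (m (\<phi> 0)) \<le> length (m (\<phi> 0)) - 1"
    by (simp only: length_tl)
  moreover have "length (m (\<phi> 0)) \<noteq> 0"
    using ne by simp
  ultimately show False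
    by linarith
qed

text \<open>The minimal words of \<open>L\<close> form an antichain, and an infinite antichain would
  contradict Higman's lemma. Every word of \<open>L\<close> lies above a minimal one because a
  proper subsequence is strictly shorter.\<close>

lemma finite_minimal_subseq:
  assumes "finite \<Sigma>" "L \<subseteq> lists \<Sigma>"
  obtains M where "finite M" "M \<subseteq> L" "\<And>w. w \<in> L \<Longrightarrow> \<exists>m\<in>M. subseq m w"
proof -
  define M where "M = {m \<in> L. \<forall>w\<in>L. subseq w m \<longrightarrow> w = m}"
  have "finite M"
  proof (rule ccontr)
    assume "infinite M"
    then obtain s :: "nat \<Rightarrow> _" where s: "inj s" "range s \<subseteq> M"
      using infinite_countable_subset by blast
    then have "\<And>n. s n \<in> lists \<Sigma>"
      using assms(2) unfolding M_def by blast
    then obtain i j where "i < j" "subseq (s i) (s j)"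
      using higman[OF assms(1)] by blast
    moreover have "s i \<in> M" "s j \<in> M"
      using s(2) by auto
    ultimately show False
      using s(1) unfolding M_def inj_def by blast
  qed
  moreover have "\<exists>m\<in>M. subseq m w" if "w \<in> L" for w
    using that
  proof (induction w rule: measure_induct_rule[of length])
    case (less w)
    show ?case
    proof (cases "w \<in> M")
      case False
      then obtain v where v: "v \<in> L" "subseq v w" "v \<noteq> w"
        using less.prems unfolding M_def by blast
      then have "length v < length w"
        by (meson le_neq_implies_less list_emb_length subseq_same_length)
      then show ?thesis
        using less.IH v(1,2) subseq_order.trans by blast
    qed auto
  qed
  ultimately show thesis
    by (intro that[of M]) (auto simp: M_def)
qed

section \<open>Ordered languages\<close>

lemma finite_language_ordered:
  assumes "finite L" "L \<subseteq> lists \<Sigma>"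
  shows "L \<in> ordered_languages \<Sigma>"
proof -
  have "{w} \<in> ordered_languages \<Sigma>" if "w \<in> lists \<Sigma>" for w
    using that
  proof (induction w)
    case Nil
    \<comment> \<open>The language of the empty word is the star of the empty alphabet.\<close>
    then show ?case
      using ordered_languages.star[of "{}" \<Sigma>] by simp
  next
    case (Cons c w)
    then show ?case
      using ordered_languages.concat[OF ordered_languages.letter[of c] Cons.IH] by simp
  qed
  then have "\<Union>((\<lambda>w. {w}) ` L) \<in> ordered_languages \<Sigma>"
    using assms by (intro ordered_languages.union) auto
  then show ?thesis
    by simp
qed

text \<open>The concatenations are nested literally, with \<open>{[c]}\<close> as a factor, so that
  the rules \<open>concat\<close>, \<open>star\<close> and \<open>letter\<close> apply as soon as
  the equations are unfolded.\<close>

fun insertions :: "'a set \<Rightarrow> 'a list \<Rightarrow> 'a list set" where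
  "insertions \<Gamma> [] = lists \<Gamma>"
| "insertions \<Gamma> (c # w) =
     {u @ v | u v. u \<in> lists \<Gamma> \<and> v \<in> {p @ q | p q. p \<in> {[c]} \<and> q \<in> insertions \<Gamma> w}}"

lemma insertions_ordered:
  assumes "\<Gamma> \<subseteq> \<Sigma>" "w \<in> lists \<Sigma>"
  shows "insertions \<Gamma> w \<in> ordered_languages \<Sigma>"
  using assms(2)
proof (induction w)
  case Nil
  then show ?case
    using ordered_languages.star[OF assms(1)] by simp
next
  case (Cons c w)
  then show ?case
    unfolding insertions.simps
    by (intro ordered_languages.concat ordered_languages.star ordered_languages.letter assms(1)) auto
qed

lemma insertions_subseq: "v \<in> insertions \<Gamma> w \<Longrightarrow> subseq w v"
proof (induction w arbitrary: v)
  case (Cons c w)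
  then obtain u q where v: "v = u @ c # q" "q \<in> insertions \<Gamma> w"
    by auto
  then have "subseq (c # w) (c # q)"
    using Cons.IH[of q] by simp
  then show ?case
    unfolding v(1) by (rule list_emb_append2)
qed simp

lemma insertions_lists: "v \<in> insertions \<Gamma> w \<Longrightarrow> set v \<subseteq> \<Gamma> \<union> set w"
proof (induction w arbitrary: v)
  case (Cons c w)
  then obtain u q where "v = u @ c # q" "u \<in> lists \<Gamma>" "q \<in> insertions \<Gamma> w"
    by auto
  then show ?case
    using Cons.IH[of q] by auto
qed auto

lemma insertions_count: "v \<in> insertions \<Gamma> w \<Longrightarrow> z \<notin> \<Gamma> \<Longrightarrow> count_list v z = count_list w z"
proof (induction w arbitrary: v)
  case Nil
  then have "z \<notin> set v"
    by auto
  then show ?case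
    by (simp add: count_list_0_iff)
next
  case (Cons c w)
  then obtain u q where v: "v = u @ c # q" "u \<in> lists \<Gamma>" "q \<in> insertions \<Gamma> w"
    by auto
  moreover have "z \<notin> set u"
    using v(2) Cons.prems(2) by auto
  then have "count_list u z = 0"
    by (simp add: count_list_0_iff)
  ultimately show ?case
    using Cons.IH[OF v(3) Cons.prems(2)] by simp
qed

lemma insertions_ConsE:
  assumes "v \<in> insertions \<Gamma> (c # w)"
  obtains u q where "v = u @ c # q" "u \<in> lists \<Gamma>" "q \<in> insertions \<Gamma> w"
  using assms by auto

lemma insertions_ConsI:
  assumes "u \<in> lists \<Gamma>" "q \<in> insertions \<Gamma> w"
  shows "u @ c # q \<in> insertions \<Gamma> (c # w)"
  using assms by simp blast

lemma insertions_insert: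
  assumes "a \<in> \<Gamma>" "v \<in> insertions \<Gamma> w"
  shows "a # v \<in> insertions \<Gamma> w"
proof (cases w)
  case (Cons c w')
  with assms obtain u q where "v = u @ c # q" "u \<in> lists \<Gamma>" "q \<in> insertions \<Gamma> w'"
    using insertions_ConsE by metis
  then show ?thesis
    using insertions_ConsI[of "a # u" \<Gamma> q w' c] assms(1) Cons by simp
qed (use assms in simp)

lemma count_list_subseq: "subseq w v \<Longrightarrow> count_list w z \<le> count_list v z"
  by (induction rule: list_emb.induct) auto

text \<open>Read \<open>v\<close> from the left: a letter is skipped whenever \<open>w\<close> still
  embeds in the rest, and otherwise it is matched with the head of \<open>w\<close>. Equality of the
  two counts ensures that no skipped letter is \<open>z\<close>, so all skipped letters lie in
  \<open>\<Gamma>\<close>.\<close>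

lemma in_insertionsI:
  assumes "subseq w v" "set v \<subseteq> insert z \<Gamma>" "count_list v z = count_list w z"
  shows "v \<in> insertions \<Gamma> w"
  using assms
proof (induction v arbitrary: w rule: list.induct)
  case (Cons b v)
  show ?case
  proof (cases "subseq w v")
    case True
    \<comment> \<open>The rest of \<open>v\<close> already contains as many \<open>z\<close> as
      \<open>w\<close> does; a skipped \<open>z\<close> would be one too many.\<close>
    have "b \<noteq> z"
      using count_list_subseq[OF True, of z] Cons.prems(3) by auto
    then show ?thesis
      using Cons True by (intro insertions_insert) auto
  next
    case False
    then obtain w' where w: "w = b # w'" "subseq w' v"
      using Cons.prems(1) by (cases w) (auto split: if_splits)
    then have "v \<in> insertions \<Gamma> w'"
      using Cons.prems by (intro Cons.IH) (auto split: if_splits)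
    then show ?thesis
      using insertions_ConsI[of "[]" \<Gamma> v w' b] w(1) by simp
  qed
next
  case Nil
  then show ?case
    by (cases w) auto
qed

section \<open>Enumerations of finite linear orders\<close>

abbreviation (input) is_order_list :: "'a set \<Rightarrow> 'a rel \<Rightarrow> 'a list \<Rightarrow> bool" where
  "is_order_list A r ts \<equiv> distinct ts \<and> set ts = A \<and> sorted_wrt (\<lambda>a b. (a, b) \<in> r) ts"

lemma order_list_exists:
  assumes "finite A" "linear_order_on A r"
  shows "\<exists>ts. is_order_list A r ts"
proof -
  have "\<exists>ts. is_order_list B r ts" if "finite B" "B \<subseteq> A" for B
    using that
  proof (induction B rule: finite_induct)
    case (insert a B)
    then obtain ts where ts: "is_order_list B r ts"
      by auto
    \<comment> \<open>The new element goes between the elements below it and the others; totality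
      puts the latter above it.\<close>
    let ?us = "filter (\<lambda>t. (t, a) \<in> r) ts @ a # filter (\<lambda>t. (t, a) \<notin> r) ts"
    have "distinct ?us" "set ?us = insert a B"
      using ts insert.hyps(2) by auto
    have "(a, t) \<in> r" if "t \<in> B" "(t, a) \<notin> r" for t
    proof -
      have "t \<in> A" "a \<in> A" "t \<noteq> a"
        using that(1) insert.prems insert.hyps(2) by auto
      then show ?thesis
        using assms(2) that(2) unfolding linear_order_on_def total_on_def by blast
    qed
    moreover have "\<forall>s t. (s, a) \<in> r \<longrightarrow> (a, t) \<in> r \<longrightarrow> (s, t) \<in> r"
      using assms(2) unfolding order_on_defs trans_def by blast
    ultimately have "sorted_wrt (\<lambda>a b. (a, b) \<in> r) ?us"
      using ts unfolding sorted_wrt_append sorted_wrt.simps set_filter list.set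
      by (intro conjI ballI sorted_wrt_filter) blast+
    with \<open>distinct ?us\<close> \<open>set ?us = insert a B\<close> have "is_order_list (insert a B) r ?us"
      by (intro conjI)
    then show ?case
      by blast
  qed simp
  then show ?thesis
    using assms(1) by blast
qed

text \<open>Two different heads would each occur in the tail of the other list, hence lie above each
  other, against antisymmetry. Below, equalities between maps are proved by comparing their lists of
  values through this uniqueness.\<close>

lemma order_list_unique:
  assumes "antisym r" "is_order_list A r ts" "is_order_list A r us"
  shows "ts = us"
  using assms(2,3)
proof (induction ts arbitrary: us A)
  case (Cons t ts)
  then obtain u us' where us: "us = u # us'"
    by (cases us) auto
  have "t = u"
  proof (rule ccontr)
    assume "t \<noteq> u"
    then have "t \<in> set us'" "u \<in> set ts"
      using Cons.prems unfolding us by auto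
    then have "(t, u) \<in> r" "(u, t) \<in> r"
      using Cons.prems unfolding us by auto
    then show False
      using \<open>t \<noteq> u\<close> assms(1) by (auto dest: antisymD)
  qed
  moreover have "ts = us'"
    using Cons.prems \<open>t = u\<close> unfolding us by (intro Cons.IH[of "A - {t}"]) auto
  ultimately show ?case
    using us by simp
qed auto

definition order_list :: "'a set \<times> 'a rel \<Rightarrow> 'a list" where
  "order_list y = (SOME ts. is_order_list (fst y) (snd y) ts)"

lemma OI_Obj: "y \<in> Obj (OI d) \<longleftrightarrow> finite (fst y) \<and> linear_order_on (fst y) (snd y)"
  by (auto simp: OI_def)

lemma order_list:
  assumes "y \<in> Obj (OI d)"
  shows "is_order_list (fst y) (snd y) (order_list y)"
  using someI_ex[OF order_list_exists[of "fst y" "snd y"]] assms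
  unfolding order_list_def OI_Obj by simp

lemma order_list_eqI:
  assumes "y \<in> Obj (OI d)" "is_order_list (fst y) (snd y) ts"
  shows "order_list y = ts"
proof (rule order_list_unique)
  show "antisym (snd y)"
    using assms(1) by (auto simp: OI_Obj order_on_defs)
  show "is_order_list (fst y) (snd y) (order_list y)"
    using order_list[OF assms(1)] .
  show "is_order_list (fst y) (snd y) ts"
    using assms(2) .
qed

lemma length_order_list: "y \<in> Obj (OI d) \<Longrightarrow> length (order_list y) = card (fst y)"
  using order_list[of y d] distinct_card[of "order_list y"] by simp

text \<open>Morphisms are built below by listing their values; this turns sortedness of the list
  into monotonicity. If \<open>t\<close> came strictly before \<open>s\<close>, antisymmetry would
  give \<open>s = t\<close>, contradicting distinctness.\<close>

lemma sorted_wrt_map_imp_mono: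
  assumes "linear_order_on A r" "is_order_list A r ts" "refl_on B q"
    and "set (map h ts) \<subseteq> B" "sorted_wrt (\<lambda>a b. (a, b) \<in> q) (map h ts)" "(s, t) \<in> r"
  shows "(h s, h t) \<in> q"
proof -
  have "s \<in> A" "t \<in> A"
    using assms(1,6) by (auto simp: order_on_defs)
  then obtain i j where ij: "i < length ts" "j < length ts" "s = ts ! i" "t = ts ! j"
    using assms(2) by (metis in_set_conv_nth)
  consider "i < j" | "i = j" | "j < i"
    by linarith
  then show ?thesis
  proof cases
    case 1
    then show ?thesis
      using sorted_wrt_nth_less[OF assms(5), of i j] ij by simp
  next
    case 2
    moreover have "h s \<in> B"
      using assms(4) ij by auto
    ultimately show ?thesis
      using assms(3) ij by (auto simp: refl_on_def)
  next
    case 3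
    then have "(t, s) \<in> r"
      using sorted_wrt_nth_less[of "\<lambda>a b. (a, b) \<in> r" ts j i] assms(2) ij by simp
    then have "s = t"
      using assms(1,6) by (auto simp: order_on_defs antisym_def)
    then show ?thesis
      using 3 ij assms(2) nth_eq_iff_index_eq by blast
  qed
qed

lemma exists_map_eq:
  assumes "distinct xs" "length xs = length ys"
  shows "\<exists>f. map f xs = ys"
proof -
  have "map (the \<circ> map_of (zip xs ys)) xs = ys"
    using assms by (intro nth_equalityI) (auto simp: map_of_zip_nth)
  then show ?thesis
    by blast
qed

section \<open>The category OI\<close>

lemma OI_Hom:
  "f \<in> Hom (OI d) x y \<longleftrightarrow>
     fst f \<in> fst x \<rightarrow>\<^sub>E fst y \<and> inj_on (fst f) (fst x) \<and>
     (\<forall>s\<in>fst x. \<forall>t\<in>fst x. (s, t) \<in> snd x \<longrightarrow> (fst f s, fst f t) \<in> snd y) \<and>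
     snd f \<in> (fst y - fst f ` fst x) \<rightarrow>\<^sub>E {1..d}"
  by (cases x; cases y; cases f) (simp add: OI_def)

lemma OI_Ident: "Ident (OI d) x = (\<lambda>s\<in>fst x. s, \<lambda>s\<in>{}. undefined)"
  by (cases x) (simp add: OI_def)

lemma OI_Comp:
  "Comp (OI d) x y z g f = (compose (fst x) (fst g) (fst f),
     \<lambda>u\<in>fst z - fst g ` fst f ` fst x.
       if u \<in> fst g ` fst y then snd f (inv_into (fst y) (fst g) u) else snd g u)"
  by (cases x; cases y; cases z; cases f; cases g) (simp add: OI_def cong: if_cong)

lemma OI_Hom_map_order_list:
  assumes "x \<in> Obj (OI d)" "f \<in> Hom (OI d) x y"
  shows "is_order_list (fst f ` fst x) (snd y) (map (fst f) (order_list x))"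
proof -
  have "sorted_wrt (\<lambda>a b. (fst f a, fst f b) \<in> snd y) (order_list x)"
    by (rule sorted_wrt_mono_rel[of _ "\<lambda>a b. (a, b) \<in> snd x"])
      (use order_list[OF assms(1)] assms(2) in \<open>auto simp: OI_Hom\<close>)
  then show ?thesis
    using order_list[OF assms(1)] assms(2)
    by (auto simp: OI_Hom sorted_wrt_map distinct_map)
qed

text \<open>The values of an order-preserving injection, taken along the source, enumerate its image
  in increasing order, and such an enumeration is unique.\<close>

lemma OI_Hom_eq_of_image_eq:
  assumes "x \<in> Obj (OI d)" "y \<in> Obj (OI d)" "f \<in> Hom (OI d) x y" "g \<in> Hom (OI d) x y"
    and "fst f ` fst x = fst g ` fst x"
  shows "fst f = fst g"
proof -
  have "map (fst f) (order_list x) = map (fst g) (order_list x)"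
  proof (rule order_list_unique)
    show "antisym (snd y)"
      using assms(2) by (auto simp: OI_Obj order_on_defs)
    show "is_order_list (fst f ` fst x) (snd y) (map (fst f) (order_list x))"
      using OI_Hom_map_order_list[OF assms(1,3)] .
    show "is_order_list (fst f ` fst x) (snd y) (map (fst g) (order_list x))"
      unfolding assms(5) using OI_Hom_map_order_list[OF assms(1,4)] .
  qed
  then have "\<forall>s\<in>fst x. fst f s = fst g s"
    using order_list[OF assms(1)] by auto
  then show ?thesis
    using assms(3,4) unfolding OI_Hom by (intro PiE_ext[of "fst f" "fst x" "\<lambda>_. fst y"]) auto
qed

section \<open>The category axioms, directedness and the norm\<close>

lemma OI_Comp_in_Hom:
  assumes "f \<in> Hom (OI d) x y" "g \<in> Hom (OI d) y z"
  shows "Comp (OI d) x y z g f \<in> Hom (OI d) x z"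
proof -
  have f: "fst f ` fst x \<subseteq> fst y" and g: "inj_on (fst g) (fst y)"
    using assms by (auto simp: OI_Hom)
  have img: "compose (fst x) (fst g) (fst f) ` fst x = fst g ` fst f ` fst x"
    by (auto simp: compose_def image_image)
  have snd: "(if u \<in> fst g ` fst y then snd f (inv_into (fst y) (fst g) u) else snd g u) \<in> {1..d}"
    if u: "u \<in> fst z - fst g ` fst f ` fst x" for u
  proof (cases "u \<in> fst g ` fst y")
    case True
    then obtain t where t: "t \<in> fst y" "u = fst g t"
      by blast
    then have "t \<notin> fst f ` fst x"
      using u by auto
    then show ?thesis
      using t g assms(1) by (auto simp: OI_Hom PiE_iff)
  next
    case False
    then show ?thesis
      using u assms(2) by (auto simp: OI_Hom PiE_iff)
  qed
  show ?thesis
    unfolding OI_Hom OI_Comp fst_conv snd_conv img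
  proof (intro conjI)
    show "compose (fst x) (fst g) (fst f) \<in> fst x \<rightarrow>\<^sub>E fst z"
      using assms by (auto simp: OI_Hom compose_def)
    show "inj_on (compose (fst x) (fst g) (fst f)) (fst x)"
      using assms(1) comp_inj_on[of "fst f" "fst x" "fst g"] inj_on_subset[OF g f]
      by (auto simp: OI_Hom compose_def inj_on_def)
    show "\<forall>s\<in>fst x. \<forall>t\<in>fst x. (s, t) \<in> snd x \<longrightarrow>
      (compose (fst x) (fst g) (fst f) s, compose (fst x) (fst g) (fst f) t) \<in> snd z"
    proof (intro ballI impI)
      fix s t assume st: "s \<in> fst x" "t \<in> fst x" "(s, t) \<in> snd x"
      then have "fst f s \<in> fst y" "fst f t \<in> fst y" "(fst f s, fst f t) \<in> snd y"
        using assms(1) f by (auto simp: OI_Hom)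
      then show "(compose (fst x) (fst g) (fst f) s, compose (fst x) (fst g) (fst f) t) \<in> snd z"
        using assms(2) st by (simp add: OI_Hom compose_def)
    qed
    show "(\<lambda>u\<in>fst z - fst g ` fst f ` fst x.
       if u \<in> fst g ` fst y then snd f (inv_into (fst y) (fst g) u) else snd g u)
       \<in> fst z - fst g ` fst f ` fst x \<rightarrow>\<^sub>E {1..d}"
      using snd by (intro restrict_PiE_iff[THEN iffD2]) blast
  qed
qed

lemma OI_Comp_assoc:
  assumes "f \<in> Hom (OI d) w x" "g \<in> Hom (OI d) x y" "h \<in> Hom (OI d) y z"
  shows "Comp (OI d) w x z (Comp (OI d) x y z h g) f = Comp (OI d) w y z h (Comp (OI d) w x y g f)"
proof -
  have f: "\<And>s. s \<in> fst w \<Longrightarrow> fst f s \<in> fst x" and g: "\<And>s. s \<in> fst x \<Longrightarrow> fst g s \<in> fst y"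
    and g_inj: "inj_on (fst g) (fst x)" and h_inj: "inj_on (fst h) (fst y)"
    using assms by (auto simp: OI_Hom)
  have hg_inj: "inj_on (compose (fst x) (fst h) (fst g)) (fst x)"
    using OI_Comp_in_Hom[OF assms(2,3)] by (simp add: OI_Hom OI_Comp)
  have hg_img: "compose (fst x) (fst h) (fst g) ` fst x = fst h ` fst g ` fst x"
    by (auto simp: compose_def image_image)
  have hgf_img: "compose (fst x) (fst h) (fst g) ` fst f ` fst w = fst h ` fst g ` fst f ` fst w"
    using f by (auto simp: compose_def image_image)
  have gf_img: "fst h ` compose (fst w) (fst g) (fst f) ` fst w = fst h ` fst g ` fst f ` fst w"
    by (auto simp: compose_def image_image)
  show ?thesis
    unfolding OI_Comp fst_conv snd_conv hgf_img gf_img hg_img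
  proof (intro prod.inject[THEN iffD2] conjI restrict_ext)
    show "compose (fst w) (compose (fst x) (fst h) (fst g)) (fst f) =
          compose (fst w) (fst h) (compose (fst w) (fst g) (fst f))"
      using f by (auto simp: compose_def restrict_def)
    fix u assume u: "u \<in> fst z - fst h ` fst g ` fst f ` fst w"
    \<comment> \<open>A point of the last object comes from \<open>x\<close>, from \<open>y\<close>
      but not from \<open>x\<close>, or from neither. On both sides its label is then taken from
      \<open>f\<close>, \<open>g\<close> or \<open>h\<close>, respectively.\<close>
    consider t where "t \<in> fst x" "u = fst h (fst g t)"
      | t where "t \<in> fst y" "t \<notin> fst g ` fst x" "u = fst h t"
      | "u \<notin> fst h ` fst y"
      by blast
    then show "(if u \<in> fst h ` fst g ` fst x
          then snd f (inv_into (fst x) (compose (fst x) (fst h) (fst g)) u)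
          else (\<lambda>u\<in>fst z - fst h ` fst g ` fst x. if u \<in> fst h ` fst y
                  then snd g (inv_into (fst y) (fst h) u) else snd h u) u) =
         (if u \<in> fst h ` fst y
          then (\<lambda>u\<in>fst y - fst g ` fst f ` fst w. if u \<in> fst g ` fst x
                  then snd f (inv_into (fst x) (fst g) u) else snd g u)
                 (inv_into (fst y) (fst h) u)
          else snd h u)"
    proof cases
      case 1
      have "inv_into (fst x) (compose (fst x) (fst h) (fst g)) u = t"
        using inv_into_f_f[OF hg_inj 1(1)] 1 by (simp add: compose_def)
      moreover have "inv_into (fst y) (fst h) u = fst g t"
        using inv_into_f_f[OF h_inj g[OF 1(1)]] 1 by simp
      moreover have "inv_into (fst x) (fst g) (fst g t) = t"
        using inv_into_f_f[OF g_inj 1(1)] .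
      moreover have "fst g t \<notin> fst g ` fst f ` fst w"
        using u 1 by auto
      moreover have "u \<in> fst h ` fst g ` fst x" "u \<in> fst h ` fst y"
        using 1 g by auto
      ultimately show ?thesis
        using 1 g by simp
    next
      case 2
      have "inv_into (fst y) (fst h) u = t"
        using inv_into_f_f[OF h_inj 2(1)] 2 by simp
      moreover have "u \<notin> fst h ` fst g ` fst x"
        using 2 h_inj g by (auto simp: inj_on_def)
      moreover have "t \<notin> fst g ` fst f ` fst w"
        using 2 f by auto
      ultimately show ?thesis
        using 2 u by simp
    next
      case 3
      moreover have "u \<notin> fst h ` fst g ` fst x"
        using 3 g by auto
      ultimately show ?thesis
        using u by simp
    qed
  qed
qed

lemma OI_Ident_in_Hom: "Ident (OI d) x \<in> Hom (OI d) x x"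
  by (auto simp: OI_Hom OI_Ident)

lemma OI_Comp_Ident:
  assumes "f \<in> Hom (OI d) x y"
  shows "Comp (OI d) x x y f (Ident (OI d) x) = f" "Comp (OI d) x y y (Ident (OI d) y) f = f"
proof -
  have f: "fst f \<in> fst x \<rightarrow>\<^sub>E fst y" "snd f \<in> fst y - fst f ` fst x \<rightarrow>\<^sub>E {1..d}"
    using assms by (auto simp: OI_Hom)
  note f1 = PiE_mem[OF f(1)] and arb = PiE_arb[OF f(1)] PiE_arb[OF f(2)]
  have "compose (fst x) (fst f) (\<lambda>s\<in>fst x. s) = fst f"
    by (rule ext) (simp add: compose_def arb)
  moreover have "compose (fst x) (\<lambda>s\<in>fst y. s) (fst f) = fst f"
    by (rule ext) (simp add: compose_def arb f1)
  \<comment> \<open>The empty labelling of an identity is never consulted: here its branch needs a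
    point of the image of \<open>f\<close>, which the domain excludes, and in the next equation
    every point lies in the image of the identity.\<close>
  moreover have "(\<lambda>u\<in>fst y - fst f ` (\<lambda>s\<in>fst x. s) ` fst x. if u \<in> fst f ` fst x
      then (\<lambda>s\<in>{}. undefined) (inv_into (fst x) (fst f) u) else snd f u) = snd f"
    by (rule ext) (simp add: restrict_def arb)
  moreover have "(\<lambda>u\<in>fst y - (\<lambda>s\<in>fst y. s) ` fst f ` fst x. if u \<in> (\<lambda>s\<in>fst y. s) ` fst y
      then snd f (inv_into (fst y) (\<lambda>s\<in>fst y. s) u) else (\<lambda>s\<in>{}. undefined) u) = snd f"
  proof -
    have "(\<lambda>s\<in>fst y. s) ` fst f ` fst x = (\<lambda>s. s) ` fst f ` fst x"
      by (rule image_cong) (auto simp: f1)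
    then have "(\<lambda>s\<in>fst y. s) ` fst f ` fst x = fst f ` fst x"
      by simp
    moreover have "inv_into (fst y) (\<lambda>s\<in>fst y. s) u = u" if "u \<in> fst y" for u
      using inv_into_f_f[of "\<lambda>s\<in>fst y. s" "fst y" u] that by (simp add: inj_on_def)
    ultimately show ?thesis
      by (intro ext) (simp add: arb)
  qed
  ultimately show "Comp (OI d) x x y f (Ident (OI d) x) = f"
      "Comp (OI d) x y y (Ident (OI d) y) f = f"
    unfolding OI_Comp OI_Ident fst_conv snd_conv by (simp_all only: prod.collapse)
qed

text \<open>An injective self-map of a finite set is surjective, so it has the same image as the
  identity and equals it. Its labelling has empty domain.\<close>

lemma OI_endomorphism:
  assumes "x \<in> Obj (OI d)" "f \<in> Hom (OI d) x x"
  shows "f = Ident (OI d) x"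
proof -
  have "fst f ` fst x = fst x"
    using assms by (intro endo_inj_surj) (auto simp: OI_Obj OI_Hom)
  moreover from this have "fst f = fst (Ident (OI d) x)"
    by (intro OI_Hom_eq_of_image_eq[OF assms(1,1,2) OI_Ident_in_Hom]) (simp add: OI_Ident)
  ultimately show ?thesis
    using assms(2) by (auto simp: OI_Hom OI_Ident prod_eq_iff)
qed

lemma directed_category_OI: "directed_category (OI d)"
  unfolding directed_category_def is_category_def
  by (intro conjI ballI OI_Ident_in_Hom OI_Comp_in_Hom OI_Comp_Ident OI_Comp_assoc OI_endomorphism)

lemma category_norm_OI: "category_norm (OI d) (\<lambda>S. card (fst S))"
  unfolding category_norm_def isomorphic_def
proof (intro ballI impI, elim bexE)
  fix x y :: "'a set \<times> 'a rel" and h k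
  assume "x \<in> Obj (OI d)" "y \<in> Obj (OI d)" "h \<in> Hom (OI d) x y" "k \<in> Hom (OI d) y x"
  then show "card (fst x) = card (fst y)"
    by (intro antisym card_inj_on_le[of "fst h"] card_inj_on_le[of "fst k"]) (auto simp: OI_Obj OI_Hom)
qed

section \<open>The word of a morphism\<close>

text \<open>Labels lie in \<open>{1..d}\<close>, which leaves 0 free as the marker of image points.
  The source \<open>S\<close> is an argument because \<open>f\<close> alone does not determine
  it.\<close>

definition letter :: "'a set \<Rightarrow> ('a \<Rightarrow> 'a) \<times> ('a \<Rightarrow> nat) \<Rightarrow> 'a \<Rightarrow> nat" where
  "letter S f t = (if t \<in> fst f ` S then 0 else snd f t)"

definition word :: "'a set \<times> 'a rel \<Rightarrow> ('a set \<times> 'a rel) \<times> ('a \<Rightarrow> 'a) \<times> ('a \<Rightarrow> nat) \<Rightarrow> nat list" where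
  "word x p = map (letter (fst x) (snd p)) (order_list (fst p))"

lemma letter_eq_0_iff:
  assumes "f \<in> Hom (OI d) x y" "t \<in> fst y"
  shows "letter (fst x) f t = 0 \<longleftrightarrow> t \<in> fst f ` fst x"
proof (cases "t \<in> fst f ` fst x")
  case False
  then have "snd f t \<in> {1..d}"
    using assms by (auto simp: OI_Hom)
  then show ?thesis
    using False by (simp add: letter_def)
qed (simp add: letter_def)

lemma letter_le:
  assumes "f \<in> Hom (OI d) x y" "t \<in> fst y"
  shows "letter (fst x) f t \<in> {0..d}"
proof (cases "t \<in> fst f ` fst x")
  case False
  then have "snd f t \<in> {1..d}"
    using assms by (auto simp: OI_Hom)
  then show ?thesis
    using False by (simp add: letter_def)
qed (simp add: letter_def)

lemma word_lists:
  assumes "y \<in> Obj (OI d)" "f \<in> Hom (OI d) x y"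
  shows "word x (y, f) \<in> lists {0..d}"
  using order_list[OF assms(1)] letter_le[OF assms(2)] by (auto simp: word_def)

lemma length_word: "y \<in> Obj (OI d) \<Longrightarrow> length (word x (y, f)) = card (fst y)"
  by (simp add: word_def length_order_list)

lemma card_image_OI_Hom:
  assumes "f \<in> Hom (OI d) x y"
  shows "card (fst f ` fst x) = card (fst x)"
  using assms by (simp add: OI_Hom card_image)

lemma count_list_map_distinct:
  assumes "distinct xs"
  shows "count_list (map f xs) z = card {x \<in> set xs. f x = z}"
proof -
  have "count_list (map f xs) z = length (filter (\<lambda>x. f x = z) xs)"
    by (induction xs) auto
  also have "\<dots> = card (set (filter (\<lambda>x. f x = z) xs))"
    using assms by (intro distinct_card[symmetric]) simp
  finally show ?thesis
    by simp
qed

text \<open>Zeros mark exactly the points of the image, and \<open>f\<close> is injective. Since the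
  count depends only on \<open>x\<close>, an embedding between words of two morphisms out of
  \<open>x\<close> must use all zeros of the larger word.\<close>

lemma count_list_word:
  assumes "y \<in> Obj (OI d)" "f \<in> Hom (OI d) x y"
  shows "count_list (word x (y, f)) 0 = card (fst x)"
proof -
  have "{t \<in> fst y. letter (fst x) f t = 0} = {t \<in> fst y. t \<in> fst f ` fst x}"
    by (simp add: letter_eq_0_iff[OF assms(2)] cong: conj_cong)
  also have "\<dots> = fst f ` fst x"
    using assms(2) by (auto simp: OI_Hom)
  finally show ?thesis
    using order_list[OF assms(1)] card_image_OI_Hom[OF assms(2)]
    by (simp add: word_def count_list_map_distinct)
qed

section \<open>Postcomposition and factorisation in terms of words\<close>

lemma filter_order_list_image:
  assumes "y \<in> Obj (OI d)" "z \<in> Obj (OI d)" "h \<in> Hom (OI d) y z"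
  shows "filter (\<lambda>u. u \<in> fst h ` fst y) (order_list z) = map (fst h) (order_list y)"
proof (rule order_list_unique)
  show "antisym (snd z)"
    using assms(2) by (auto simp: OI_Obj order_on_defs)
  show "is_order_list (fst h ` fst y) (snd z) (map (fst h) (order_list y))"
    using OI_Hom_map_order_list[OF assms(1,3)] .
  have "fst h ` fst y \<subseteq> fst z"
    using assms(3) by (auto simp: OI_Hom)
  then have "{u \<in> fst z. u \<in> fst h ` fst y} = fst h ` fst y"
    by blast
  then show "is_order_list (fst h ` fst y) (snd z) (filter (\<lambda>u. u \<in> fst h ` fst y) (order_list z))"
    using order_list[OF assms(2)] by (simp add: sorted_wrt_filter)
qed

lemma letter_Comp:
  assumes "f \<in> Hom (OI d) x y" "h \<in> Hom (OI d) y z"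
  shows "t \<in> fst y \<Longrightarrow> letter (fst x) (Comp (OI d) x y z h f) (fst h t) = letter (fst x) f t"
    and "u \<in> fst z - fst h ` fst y \<Longrightarrow> letter (fst x) (Comp (OI d) x y z h f) u = snd h u"
proof -
  have f: "fst f ` fst x \<subseteq> fst y" and h: "inj_on (fst h) (fst y)" "fst h ` fst y \<subseteq> fst z"
    using assms by (auto simp: OI_Hom)
  have img: "compose (fst x) (fst h) (fst f) ` fst x = fst h ` fst f ` fst x"
    by (auto simp: compose_def image_image)
  show "letter (fst x) (Comp (OI d) x y z h f) (fst h t) = letter (fst x) f t" if t: "t \<in> fst y"
  proof -
    have "fst h t \<in> fst h ` fst f ` fst x \<longleftrightarrow> t \<in> fst f ` fst x"
      using inj_on_image_mem_iff[OF h(1) t f] .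
    moreover have "inv_into (fst y) (fst h) (fst h t) = t"
      using inv_into_f_f[OF h(1) t] .
    ultimately show ?thesis
      using t h(2) by (auto simp: letter_def OI_Comp img)
  qed
  show "letter (fst x) (Comp (OI d) x y z h f) u = snd h u" if "u \<in> fst z - fst h ` fst y"
  proof -
    have "u \<notin> fst h ` fst f ` fst x"
      using that f by blast
    then show ?thesis
      using that by (simp add: letter_def OI_Comp img)
  qed
qed

lemma filter_word_Comp:
  assumes "y \<in> Obj (OI d)" "z \<in> Obj (OI d)" "f \<in> Hom (OI d) x y" "h \<in> Hom (OI d) y z"
  shows "map (letter (fst x) (Comp (OI d) x y z h f)) (filter (\<lambda>u. u \<in> fst h ` fst y) (order_list z))
    = word x (y, f)"
  using order_list[OF assms(1)] letter_Comp(1)[OF assms(3,4)]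
  unfolding filter_order_list_image[OF assms(1,2,4)] by (simp add: word_def)

lemma subseq_word_Comp:
  assumes "y \<in> Obj (OI d)" "z \<in> Obj (OI d)" "f \<in> Hom (OI d) x y" "h \<in> Hom (OI d) y z"
  shows "subseq (word x (y, f)) (word x (z, Comp (OI d) x y z h f))"
  unfolding filter_word_Comp[OF assms, symmetric]
  by (simp add: word_def subseq_map)

text \<open>Positions outside \<open>p\<close> carry equal letters, so restoring them leaves the
  first difference between the two words at the same element.\<close>

lemma lex_map_extend:
  assumes "\<And>u. u \<in> set us \<Longrightarrow> \<not> p u \<Longrightarrow> a u = b u"
    and "(map a (filter p us), map b (filter p us)) \<in> lex R"
  shows "(map a us, map b us) \<in> lex R"
  using assms
proof (induction us)
  case (Cons u us)
  then show ?case
    by (cases "p u") auto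
qed simp

lemma lex_word_Comp:
  assumes "y \<in> Obj (OI d)" "z \<in> Obj (OI d)"
    and "f \<in> Hom (OI d) x y" "f' \<in> Hom (OI d) x y" "h \<in> Hom (OI d) y z"
    and "(word x (y, f), word x (y, f')) \<in> lex R"
  shows "(word x (z, Comp (OI d) x y z h f), word x (z, Comp (OI d) x y z h f')) \<in> lex R"
  unfolding word_def fst_conv snd_conv
proof (rule lex_map_extend[where p = "\<lambda>u. u \<in> fst h ` fst y"])
  fix u assume "u \<in> set (order_list z)" "u \<notin> fst h ` fst y"
  then have "u \<in> fst z - fst h ` fst y"
    using order_list[OF assms(2)] by simp
  then show "letter (fst x) (Comp (OI d) x y z h f) u = letter (fst x) (Comp (OI d) x y z h f') u"
    using letter_Comp(2)[OF assms(3,5)] letter_Comp(2)[OF assms(4,5)] by simp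
qed (use assms(6) in \<open>simp only: filter_word_Comp[OF assms(1,2,3,5)] filter_word_Comp[OF assms(1,2,4,5)]\<close>)

text \<open>The positions of the subsequence tell where \<open>h\<close> sends the points of
  \<open>y\<close>, and outside the image \<open>h\<close> borrows the labels of \<open>f'\<close>.
  Counting zeros shows that \<open>h f\<close> has the same image as \<open>f'\<close>, which
  determines the underlying map; the labels agree because the letters do.\<close>

lemma exists_Comp_of_subseq_word:
  assumes x: "x \<in> Obj (OI d)" and y: "y \<in> Obj (OI d)" and z: "z \<in> Obj (OI d)"
    and f: "f \<in> Hom (OI d) x y" and f': "f' \<in> Hom (OI d) x z"
    and sub: "subseq (word x (y, f)) (word x (z, f'))"
  shows "\<exists>h \<in> Hom (OI d) y z. f' = Comp (OI d) x y z h f"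
proof -
  let ?l = "letter (fst x) f" and ?l' = "letter (fst x) f'"
  note oy = order_list[OF y] and oz = order_list[OF z]
  obtain N where "word x (y, f) = nths (word x (z, f')) N"
    using sub by (auto simp: subseq_conv_nths)
  then have N: "map ?l (order_list y) = map ?l' (nths (order_list z) N)"
    by (simp add: word_def nths_map)
  then have "length (order_list y) = length (nths (order_list z) N)"
    by (metis length_map)
  then obtain e where e: "map e (order_list y) = nths (order_list z) N"
    using exists_map_eq oy by blast
  define h1 where "h1 = (\<lambda>t\<in>fst y. e t)"
  have h1: "map h1 (order_list y) = nths (order_list z) N"
    unfolding e[symmetric] h1_def using oy by (intro map_cong) auto
  have h1_order: "is_order_list (h1 ` fst y) (snd z) (map h1 (order_list y))"
  proof -
    \<comment> \<open>On a distinct list, selecting positions is the same as filtering by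
      membership, which preserves sortedness.\<close>
    have "sorted_wrt (\<lambda>a b. (a, b) \<in> snd z) (nths (order_list z) N)"
      using oz filter_in_nths[of "order_list z" N] sorted_wrt_filter by metis
    then show ?thesis
      using oy oz distinct_nthsI[of "order_list z" N] unfolding h1 by (auto simp flip: h1)
  qed
  have h1_img: "h1 ` fst y \<subseteq> fst z"
  proof -
    have "set (map h1 (order_list y)) \<subseteq> fst z"
      unfolding h1 using oz set_nths_subset by metis
    then show ?thesis
      using oy by simp
  qed
  have h1_inj: "inj_on h1 (fst y)"
    using h1_order oy by (simp add: distinct_map)
  have l: "?l' (h1 t) = ?l t" if "t \<in> fst y" for t
  proof -
    have "map ?l (order_list y) = map ?l' (map h1 (order_list y))"
      using N h1 by simp
    then show ?thesis
      using that oy by (auto simp: map_eq_conv)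
  qed
  have fy: "fst f ` fst x \<subseteq> fst y"
    using f by (auto simp: OI_Hom)
  \<comment> \<open>Letters are preserved, so zeros go to zeros, which gives one inclusion. Both
    sides have as many elements as \<open>fst x\<close>, hence they coincide.\<close>
  have img: "h1 ` fst f ` fst x = fst f' ` fst x"
  proof (rule card_subset_eq)
    show "finite (fst f' ` fst x)"
      using x by (simp add: OI_Obj)
    show "h1 ` fst f ` fst x \<subseteq> fst f' ` fst x"
    proof
      fix u assume "u \<in> h1 ` fst f ` fst x"
      then obtain t where t: "t \<in> fst f ` fst x" "u = h1 t"
        by blast
      then have "t \<in> fst y" "u \<in> fst z"
        using fy h1_img by auto
      moreover have "?l t = 0"
        using t(1) by (simp add: letter_def)
      ultimately show "u \<in> fst f' ` fst x"
        using l[of t] t(2) letter_eq_0_iff[OF f', of u] by simp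
    qed
    have "inj_on h1 (fst f ` fst x)"
      using h1_inj fy by (rule inj_on_subset)
    then show "card (h1 ` fst f ` fst x) = card (fst f' ` fst x)"
      using card_image_OI_Hom[OF f] card_image_OI_Hom[OF f'] by (simp add: card_image)
  qed
  \<comment> \<open>Off the image of \<open>h1\<close> the labels of \<open>f'\<close> are
    available: by \<open>img\<close>, the image of \<open>f'\<close> lies inside that of
    \<open>h1\<close>.\<close>
  define h where "h = (h1, \<lambda>u\<in>fst z - h1 ` fst y. snd f' u)"
  have "h \<in> Hom (OI d) y z"
    unfolding OI_Hom
  proof (intro conjI ballI impI)
    show "fst h \<in> fst y \<rightarrow>\<^sub>E fst z"
      using h1_img by (auto simp: h_def h1_def)
    show "inj_on (fst h) (fst y)"
      using h1_inj by (simp add: h_def)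
    show "(fst h s, fst h t) \<in> snd z" if "(s, t) \<in> snd y" for s t
    proof -
      have "(h1 s, h1 t) \<in> snd z"
      proof (rule sorted_wrt_map_imp_mono[where h = h1 and ts = "order_list y"])
        show "linear_order_on (fst y) (snd y)"
          using y by (simp add: OI_Obj)
        show "is_order_list (fst y) (snd y) (order_list y)"
          using oy .
        show "refl_on (fst z) (snd z)"
          using z by (simp add: OI_Obj order_on_defs)
        show "set (map h1 (order_list y)) \<subseteq> fst z"
          using h1_img h1_order by simp
      qed (use h1_order that in simp_all)
      then show ?thesis
        by (simp add: h_def)
    qed
    have "snd f' u \<in> {1..d}" if u: "u \<in> fst z - h1 ` fst y" for u
    proof -
      have "u \<in> fst z - fst f' ` fst x"
        using u fy unfolding img[symmetric] by blast
      then show ?thesis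
        using f' by (auto simp: OI_Hom)
    qed
    then show "snd h \<in> (fst z - fst h ` fst y) \<rightarrow>\<^sub>E {1..d}"
      by (auto simp: h_def)
  qed
  moreover have "Comp (OI d) x y z h f = f'"
  proof -
    let ?c = "Comp (OI d) x y z h f"
    have c: "?c \<in> Hom (OI d) x z"
      using f \<open>h \<in> Hom (OI d) y z\<close> by (rule OI_Comp_in_Hom)
    have c_img: "fst ?c ` fst x = fst f' ` fst x"
      unfolding img[symmetric] by (auto simp: OI_Comp h_def compose_def image_image)
    have "fst ?c = fst f'"
      using OI_Hom_eq_of_image_eq[OF x z c f' c_img] .
    moreover have "snd ?c = snd f'"
    proof (rule PiE_ext)
      show "snd ?c \<in> (fst z - fst f' ` fst x) \<rightarrow>\<^sub>E {1..d}"
        using c unfolding OI_Hom c_img by blast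
      show "snd f' \<in> (fst z - fst f' ` fst x) \<rightarrow>\<^sub>E {1..d}"
        using f' unfolding OI_Hom by blast
      fix u assume u: "u \<in> fst z - fst f' ` fst x"
      \<comment> \<open>Off the common image a letter is the label itself, so comparing letters
        suffices.\<close>
      have "letter (fst x) ?c u = ?l' u"
      proof (cases "u \<in> h1 ` fst y")
        case True
        then obtain t where "t \<in> fst y" "u = fst h t"
          by (auto simp: h_def)
        then show ?thesis
          using letter_Comp(1)[OF f \<open>h \<in> Hom (OI d) y z\<close>] l[of t] by (simp add: h_def)
      next
        case False
        then show ?thesis
          using letter_Comp(2)[OF f \<open>h \<in> Hom (OI d) y z\<close>, of u] u by (simp add: h_def letter_def)
      qed
      then show "snd ?c u = snd f' u"
        using u unfolding letter_def c_img by simp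
    qed
    ultimately show ?thesis
      by (rule prod_eqI)
  qed
  ultimately show ?thesis
    by blast
qed

text \<open>The positions of \<open>w\<close> serve as target, and \<open>x\<close> is mapped in
  increasing order onto the positions of the zeros. Infinitely many elements of the type guarantee
  that a target of any finite size exists.\<close>

lemma exists_word:
  fixes x :: "'a set \<times> 'a rel"
  assumes x: "x \<in> Obj (OI d)" and inf: "infinite (UNIV :: 'a set)"
    and w: "w \<in> lists {0..d}" "count_list w 0 = card (fst x)"
  shows "\<exists>z \<in> Obj (OI d). \<exists>f \<in> Hom (OI d) x z. word x (z, f) = w"
proof -
  obtain A :: "'a set" where "finite A" "card A = length w"
    using infinite_arbitrarily_large[OF inf] by blast
  then obtain as where as: "set as = A" "distinct as" "length as = length w"
    using finite_distinct_list distinct_card by metis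
  \<comment> \<open>The order is by index in \<open>as\<close>, so that \<open>as\<close> becomes
    the order list of the target.\<close>
  define r where "r = {(as ! i, as ! j) | i j. i \<le> j \<and> j < length as}"
  have r: "(as ! i, as ! j) \<in> r \<longleftrightarrow> i \<le> j" if "i < length as" "j < length as" for i j
    unfolding r_def using that as(2) by (auto simp: nth_eq_iff_index_eq)
  have rE: "\<exists>i j. a = as ! i \<and> b = as ! j \<and> i \<le> j \<and> j < length as" if "(a, b) \<in> r" for a b
    using that unfolding r_def by blast
  have "linear_order_on A r"
    unfolding order_on_defs
  proof (intro conjI)
    show "r \<subseteq> A \<times> A"
      unfolding r_def as(1)[symmetric] by auto
    show "refl_on A r"
      unfolding as(1)[symmetric] refl_on_def using r by (metis in_set_conv_nth order_refl)
    show "trans r"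
    proof (rule transI)
      fix a b c assume ab: "(a, b) \<in> r" and bc: "(b, c) \<in> r"
      obtain i j where ij: "a = as ! i" "b = as ! j" "i \<le> j" "j < length as"
        using rE[OF ab] by blast
      obtain k l where kl: "b = as ! k" "c = as ! l" "k \<le> l" "l < length as"
        using rE[OF bc] by blast
      have "j = k"
        using ij kl as(2) by (metis le_less_trans nth_eq_iff_index_eq)
      then show "(a, c) \<in> r"
        using ij kl r[of i l] by simp
    qed
    show "antisym r"
    proof (rule antisymI)
      fix a b assume ab: "(a, b) \<in> r" and ba: "(b, a) \<in> r"
      obtain i j where ij: "a = as ! i" "b = as ! j" "i \<le> j" "j < length as"
        using rE[OF ab] by blast
      then have "j \<le> i"
        using ba r[of j i] by simp
      then show "a = b"
        using ij by simp
    qed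
    show "total_on A r"
      unfolding total_on_def as(1)[symmetric] using r by (metis in_set_conv_nth nat_le_linear)
  qed
  then have z: "(A, r) \<in> Obj (OI d)"
    using \<open>finite A\<close> by (simp add: OI_Obj)
  have as_order: "is_order_list A r as"
    using as r by (auto simp: sorted_wrt_iff_nth_less)
  then have oz: "order_list (A, r) = as"
    by (intro order_list_eqI[OF z]) simp
  obtain a where a: "map a as = w"
    using exists_map_eq as by blast
  let ?Z = "{u \<in> A. a u = 0}"
  \<comment> \<open>The future image of \<open>f\<close>, in increasing order; the hypothesis on the
    count makes it as long as the order list of \<open>x\<close>.\<close>
  define zs where "zs = filter (\<lambda>u. a u = 0) as"
  have zs: "is_order_list ?Z r zs"
    using as_order by (simp add: zs_def sorted_wrt_filter)
  note ox = order_list[OF x]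
  have "length zs = card ?Z"
    using zs distinct_card by metis
  also have "\<dots> = count_list w 0"
    unfolding a[symmetric] count_list_map_distinct[OF as(2)] as(1) ..
  finally have "length zs = length (order_list x)"
    using w(2) length_order_list[OF x] by simp
  then obtain e where e: "map e (order_list x) = zs"
    using exists_map_eq[of "order_list x" zs] ox by auto
  define f1 where "f1 = (\<lambda>s\<in>fst x. e s)"
  have f1: "map f1 (order_list x) = zs"
    unfolding e[symmetric] f1_def using ox by (intro map_cong) auto
  have f1_img: "f1 ` fst x = ?Z"
    using zs ox unfolding f1[symmetric] by simp
  define f where "f = (f1, \<lambda>u\<in>A - f1 ` fst x. a u)"
  have "f \<in> Hom (OI d) x (A, r)"
    unfolding OI_Hom fst_conv snd_conv
  proof (intro conjI ballI impI)
    show "fst f \<in> fst x \<rightarrow>\<^sub>E A"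
      using f1_img by (auto simp: f_def f1_def)
    show "inj_on (fst f) (fst x)"
      using zs ox unfolding f1[symmetric] by (simp add: f_def distinct_map)
    show "(fst f s, fst f t) \<in> r" if "(s, t) \<in> snd x" for s t
    proof -
      have "(f1 s, f1 t) \<in> r"
      proof (rule sorted_wrt_map_imp_mono[where h = f1 and ts = "order_list x"])
        show "linear_order_on (fst x) (snd x)"
          using x by (simp add: OI_Obj)
        show "is_order_list (fst x) (snd x) (order_list x)"
          using ox .
        show "refl_on A r"
          using \<open>linear_order_on A r\<close> by (simp add: order_on_defs)
        show "set (map f1 (order_list x)) \<subseteq> A"
          using zs unfolding f1 by auto
        show "sorted_wrt (\<lambda>a b. (a, b) \<in> r) (map f1 (order_list x))"
          using zs unfolding f1 by blast
      qed (use that in simp)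
      then show ?thesis
        by (simp add: f_def)
    qed
    have "a u \<in> {1..d}" if u: "u \<in> A - ?Z" for u
    proof -
      have "a u \<in> set w"
        using u unfolding a[symmetric] as(1)[symmetric] by auto
      then have "a u \<le> d"
        using w(1) by auto
      then show ?thesis
        using u by (auto simp: Suc_le_eq)
    qed
    then show "snd f \<in> (A - fst f ` fst x) \<rightarrow>\<^sub>E {1..d}"
      unfolding f_def fst_conv snd_conv f1_img by auto
  qed
  moreover have "word x ((A, r), f) = w"
  proof -
    have "letter (fst x) f u = a u" if "u \<in> A" for u
      unfolding letter_def f_def fst_conv snd_conv f1_img using that by auto
    then show ?thesis
      unfolding word_def fst_conv snd_conv oz a[symmetric] using as(1) by auto
  qed
  ultimately show ?thesis
    using z by blast
qed

section \<open>Words of isomorphism classes\<close>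

lemma coslice_Obj:
  "(y, f) \<in> Obj (coslice C x) \<longleftrightarrow> y \<in> Obj C \<and> f \<in> Hom C x y"
  by (simp add: coslice_def)

text \<open>Mutual factorisations embed each word in the other, and the subsequence order is
  antisymmetric. Conversely, equal words give factorisations in both directions.\<close>

lemma isomorphic_coslice_OI_iff:
  assumes x: "x \<in> Obj (OI d)"
    and p: "p \<in> Obj (coslice (OI d) x)" and q: "q \<in> Obj (coslice (OI d) x)"
  shows "isomorphic (coslice (OI d) x) p q \<longleftrightarrow> word x p = word x q"
proof -
  obtain y f where [simp]: "p = (y, f)"
    by (cases p)
  obtain z g where [simp]: "q = (z, g)"
    by (cases q)
  have y: "y \<in> Obj (OI d)" "f \<in> Hom (OI d) x y" and z: "z \<in> Obj (OI d)" "g \<in> Hom (OI d) x z"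
    using p q by (simp_all add: coslice_Obj)
  show ?thesis
  proof
    assume "isomorphic (coslice (OI d) x) p q"
    then obtain h k where "h \<in> Hom (OI d) y z" "Comp (OI d) x y z h f = g"
        "k \<in> Hom (OI d) z y" "Comp (OI d) x z y k g = f"
      by (auto simp: isomorphic_def coslice_def)
    then show "word x p = word x q"
      using subseq_word_Comp[OF y(1) z(1) y(2)] subseq_word_Comp[OF z(1) y(1) z(2)]
        subseq_order.antisym by fastforce
  next
    assume w: "word x p = word x q"
    obtain h where h: "h \<in> Hom (OI d) y z" "g = Comp (OI d) x y z h f"
      using exists_Comp_of_subseq_word[OF x y(1) z(1) y(2) z(2)] w by auto
    obtain k where k: "k \<in> Hom (OI d) z y" "f = Comp (OI d) x z y k g"
      using exists_Comp_of_subseq_word[OF x z(1) y(1) z(2) y(2)] w by auto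
    \<comment> \<open>Both composites are endomorphisms, hence identities by directedness.\<close>
    have "Comp (OI d) y z y k h = Ident (OI d) y" "Comp (OI d) z y z h k = Ident (OI d) z"
      using OI_endomorphism OI_Comp_in_Hom y(1) z(1) h(1) k(1) by metis+
    then show "isomorphic (coslice (OI d) x) p q"
      using h k unfolding isomorphic_def
      by (intro bexI[of _ h] bexI[of _ k]) (auto simp: coslice_def)
  qed
qed

lemma iso_rel_coslice_OI:
  assumes "x \<in> Obj (OI d)"
  shows "iso_rel (coslice (OI d) x) =
    {(p, q). p \<in> Obj (coslice (OI d) x) \<and> q \<in> Obj (coslice (OI d) x) \<and> word x p = word x q}"
  using isomorphic_coslice_OI_iff[OF assms] by (auto simp: iso_rel_def)

text \<open>The chosen representative is immaterial, since isomorphic morphisms have equal words;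
  see \<open>class_word_morphism_class\<close>.\<close>

definition class_word ::
  "'a set \<times> 'a rel \<Rightarrow> (('a set \<times> 'a rel) \<times> ('a \<Rightarrow> 'a) \<times> ('a \<Rightarrow> nat)) set \<Rightarrow> nat list" where
  "class_word x P = word x (SOME p. p \<in> P)"

lemma morphism_classes_OI_E:
  assumes "x \<in> Obj (OI d)" "P \<in> morphism_classes (OI d) x"
  obtains y f where "y \<in> Obj (OI d)" "f \<in> Hom (OI d) x y" "P = morphism_class (OI d) x y f"
  using assms(2) unfolding iso_classes_def quotient_def morphism_class_def
  by (auto simp: coslice_Obj)

lemma morphism_class_in_classes:
  "y \<in> Obj C \<Longrightarrow> f \<in> Hom C x y \<Longrightarrow> morphism_class C x y f \<in> morphism_classes C x"
  unfolding iso_classes_def morphism_class_def by (intro quotientI) (simp add: coslice_Obj)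

lemma morphism_class_OI:
  assumes "x \<in> Obj (OI d)" "y \<in> Obj (OI d)" "f \<in> Hom (OI d) x y"
  shows "morphism_class (OI d) x y f =
    {(z, g). z \<in> Obj (OI d) \<and> g \<in> Hom (OI d) x z \<and> word x (z, g) = word x (y, f)}"
  unfolding morphism_class_def iso_rel_coslice_OI[OF assms(1)]
  using assms(2,3) by (auto simp: coslice_Obj)

lemma class_word_morphism_class:
  assumes "x \<in> Obj (OI d)" "y \<in> Obj (OI d)" "f \<in> Hom (OI d) x y"
  shows "class_word x (morphism_class (OI d) x y f) = word x (y, f)"
proof -
  have "(y, f) \<in> morphism_class (OI d) x y f"
    using assms by (simp add: morphism_class_OI)
  then have "(SOME p. p \<in> morphism_class (OI d) x y f) \<in> morphism_class (OI d) x y f"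
    by (rule someI)
  then show ?thesis
    unfolding class_word_def morphism_class_OI[OF assms] by auto
qed

lemma inj_on_class_word:
  assumes "x \<in> Obj (OI d)"
  shows "inj_on (class_word x) (morphism_classes (OI d) x)"
proof (rule inj_onI)
  fix P Q
  assume P: "P \<in> morphism_classes (OI d) x" and Q: "Q \<in> morphism_classes (OI d) x"
    and eq: "class_word x P = class_word x Q"
  obtain y f where y: "y \<in> Obj (OI d)" "f \<in> Hom (OI d) x y" "P = morphism_class (OI d) x y f"
    using morphism_classes_OI_E[OF assms P] .
  obtain z g where z: "z \<in> Obj (OI d)" "g \<in> Hom (OI d) x z" "Q = morphism_class (OI d) x z g"
    using morphism_classes_OI_E[OF assms Q] .
  have "word x (y, f) = word x (z, g)"
    using eq y z assms by (simp add: class_word_morphism_class)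
  then show "P = Q"
    unfolding y(3) z(3) morphism_class_OI[OF assms y(1,2)] morphism_class_OI[OF assms z(1,2)] by simp
qed

lemma class_word_lists:
  assumes "x \<in> Obj (OI d)" "P \<in> morphism_classes (OI d) x"
  shows "class_word x P \<in> lists {0..d}" "count_list (class_word x P) 0 = card (fst x)"
  using morphism_classes_OI_E[OF assms] class_word_morphism_class[OF assms(1)]
    word_lists count_list_word by metis+

lemma morphism_le_OI:
  assumes x: "x \<in> Obj (OI d)" and P: "P \<in> morphism_classes (OI d) x"
    and Q: "Q \<in> morphism_classes (OI d) x" and sub: "subseq (class_word x P) (class_word x Q)"
  shows "morphism_le (OI d) x P Q"
proof -
  obtain y f where y: "y \<in> Obj (OI d)" "f \<in> Hom (OI d) x y" "P = morphism_class (OI d) x y f"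
    using morphism_classes_OI_E[OF x P] .
  obtain z g where z: "z \<in> Obj (OI d)" "g \<in> Hom (OI d) x z" "Q = morphism_class (OI d) x z g"
    using morphism_classes_OI_E[OF x Q] .
  have "(y, f) \<in> P" "(z, g) \<in> Q"
    using x y z by (simp_all add: morphism_class_OI)
  moreover have "subseq (word x (y, f)) (word x (z, g))"
    using sub x y z by (simp add: class_word_morphism_class)
  then have "\<exists>h\<in>Hom (OI d) y z. g = Comp (OI d) x y z h f"
    using x y z by (intro exists_Comp_of_subseq_word)
  ultimately show ?thesis
    unfolding morphism_le_def by blast
qed

section \<open>The two Groebner conditions and the languages of ideals\<close>

lemma noetherian_morphisms_OI:
  assumes "x \<in> Obj (OI d)"
  shows "noetherian_morphisms (OI d) x"
  unfolding noetherian_morphisms_def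
proof (intro allI impI)
  fix s :: "nat \<Rightarrow> _"
  assume s: "\<forall>n. s n \<in> morphism_classes (OI d) x"
  then have "class_word x (s n) \<in> lists {0..d}" for n
    using class_word_lists(1)[OF assms] by blast
  then obtain i j where "i < j" "subseq (class_word x (s i)) (class_word x (s j))"
    using higman[of "{0..d}" "\<lambda>n. class_word x (s n)"] by auto
  then show "\<exists>i j. i < j \<and> morphism_le (OI d) x (s i) (s j)"
    using morphism_le_OI[OF assms] s by blast
qed

text \<open>Transfers a strict well-order on words to a reflexive one on classes. Well-foundedness
  makes \<open>R\<close> irreflexive, so elements below each other have equal images, and
  injectivity of \<open>\<phi>\<close> identifies them.\<close>

lemma well_order_on_inv_image:
  assumes "inj_on \<phi> A" "wf R" "trans R" "total R"
  shows "well_order_on A {(a, b). a \<in> A \<and> b \<in> A \<and> (\<phi> a, \<phi> b) \<in> R\<^sup>=}"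
    (is "well_order_on A ?r")
proof -
  have irrefl: "(a, a) \<notin> R" for a
    using assms(2) by simp
  have "antisym ?r"
  proof (rule antisymI)
    fix a b assume "(a, b) \<in> ?r" "(b, a) \<in> ?r"
    moreover from this have "\<phi> a = \<phi> b"
      using assms(3) irrefl by (auto dest: transD)
    ultimately show "a = b"
      using assms(1) by (auto dest: inj_onD)
  qed
  moreover have "trans ?r"
    using assms(3) by (auto intro!: transI dest: transD)
  moreover have "total_on A ?r"
    using assms(4) unfolding total_on_def by auto
  moreover have "wf (?r - Id)"
  proof (rule wf_subset)
    show "wf (inv_image R \<phi>)"
      using assms(2) by (rule wf_inv_image)
    show "?r - Id \<subseteq> inv_image R \<phi>"
      using assms(1) by (auto simp: inv_image_def dest: inj_onD)
  qed
  ultimately show ?thesis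
    unfolding order_on_defs by (auto simp: refl_on_def)
qed

lemma admissible_order_OI:
  assumes x: "x \<in> Obj (OI d)"
  shows "\<exists>r. admissible_order (OI d) x r"
proof -
  let ?C = "morphism_classes (OI d) x" and ?w = "class_word x"
  \<comment> \<open>\<open>lenlex\<close> is a total well-founded order on all words, whereas
    \<open>lex\<close> compares only words of equal length.\<close>
  define r where "r = {(P, Q). P \<in> ?C \<and> Q \<in> ?C \<and> (?w P, ?w Q) \<in> (lenlex less_than)\<^sup>=}"
  have wo: "well_order_on ?C r"
    unfolding r_def using inj_on_class_word[OF x]
    by (intro well_order_on_inv_image wf_lenlex lenlex_transI total_lenlex) auto
  have strict: "(P, Q) \<in> r - Id \<longleftrightarrow> (?w P, ?w Q) \<in> lenlex less_than" if "P \<in> ?C" "Q \<in> ?C" for P Q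
    using that inj_on_class_word[OF x] lenlex_irreflexive[of less_than]
    unfolding r_def by (auto dest: inj_onD)
  have mono: "(morphism_class (OI d) x z (Comp (OI d) x y z g f),
        morphism_class (OI d) x z (Comp (OI d) x y z g f')) \<in> r - Id"
    if y: "y \<in> Obj (OI d)" and z: "z \<in> Obj (OI d)" and f: "f \<in> Hom (OI d) x y" "f' \<in> Hom (OI d) x y"
      and g: "g \<in> Hom (OI d) y z"
      and less: "(morphism_class (OI d) x y f, morphism_class (OI d) x y f') \<in> r - Id"
    for y z f f' g
  proof -
    note gf = OI_Comp_in_Hom[OF f(1) g] OI_Comp_in_Hom[OF f(2) g]
    have "(word x (y, f), word x (y, f')) \<in> lenlex less_than"
      using less strict[OF morphism_class_in_classes morphism_class_in_classes, OF y f(1) y f(2)]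
      by (simp add: class_word_morphism_class x y f)
    \<comment> \<open>Morphisms with a common target have words of equal length, so the comparison
      is purely lexicographic and postcomposition preserves it.\<close>
    then have "(word x (y, f), word x (y, f')) \<in> lex less_than"
      using length_word[OF y] by (simp add: lenlex_conv)
    then have "(word x (z, Comp (OI d) x y z g f), word x (z, Comp (OI d) x y z g f')) \<in> lex less_than"
      by (rule lex_word_Comp[OF y z f g])
    then have "(word x (z, Comp (OI d) x y z g f), word x (z, Comp (OI d) x y z g f')) \<in> lenlex less_than"
      using length_word[OF z] by (simp add: lenlex_conv)
    then show ?thesis
      using strict[OF morphism_class_in_classes morphism_class_in_classes, OF z gf(1) z gf(2)]
      by (simp add: class_word_morphism_class x z gf)
  qed
  have "admissible_order (OI d) x r"
    unfolding admissible_order_def by (intro conjI ballI impI wo mono)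
  then show ?thesis
    by blast
qed

text \<open>For an infinite type, the language is the union of \<open>insertions {1..d} m\<close>
  over its finitely many minimal words \<open>m\<close>. A word of the ideal arises from some
  \<open>m\<close> without inserted zeros, as the zero counts agree. Conversely, every word obtained
  by insertion is realised by a morphism above a member of the ideal.\<close>

lemma ideal_language_ordered:
  fixes x :: "'a set \<times> 'a rel"
  assumes x: "x \<in> Obj (OI d)" and J: "morphism_ideal (OI d) x J"
  shows "class_word x ` J \<in> ordered_languages {0..d}"
proof -
  let ?L = "class_word x ` J"
  have JC: "J \<subseteq> morphism_classes (OI d) x"
    using J by (simp add: morphism_ideal_def)
  then have L: "?L \<subseteq> lists {0..d}"
    using class_word_lists(1)[OF x] by blast
  have L_count: "count_list w 0 = card (fst x)" if "w \<in> ?L" for w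
    using that JC class_word_lists(2)[OF x] by blast
  show ?thesis
  proof (cases "finite (UNIV :: 'a set)")
    case True
    \<comment> \<open>Objects have bounded size here, so not every word is realised, but the language is finite.\<close>
    have "?L \<subseteq> {w. set w \<subseteq> {0..d} \<and> length w \<le> card (UNIV :: 'a set)}"
    proof
      fix w assume w: "w \<in> ?L"
      then obtain P where P: "P \<in> morphism_classes (OI d) x" "w = class_word x P"
        using JC by blast
      then obtain y f where "y \<in> Obj (OI d)" "f \<in> Hom (OI d) x y" "P = morphism_class (OI d) x y f"
        using morphism_classes_OI_E[OF x P(1)] by blast
      then have "length w = card (fst y)"
        using P(2) x by (simp add: class_word_morphism_class length_word)
      then show "w \<in> {w. set w \<subseteq> {0..d} \<and> length w \<le> card (UNIV :: 'a set)}"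
        using L w True card_mono[of UNIV "fst y"] by auto
    qed
    then have "finite ?L"
      by (rule finite_subset) (simp add: finite_lists_length_le)
    then show ?thesis
      using L by (rule finite_language_ordered)
  next
    case False
    obtain M where M: "finite M" "M \<subseteq> ?L" "\<And>w. w \<in> ?L \<Longrightarrow> \<exists>m\<in>M. subseq m w"
      using finite_minimal_subseq[OF _ L] by auto
    have "?L = \<Union>(insertions {1..d} ` M)"
    proof (intro subset_antisym subsetI)
      fix w assume w: "w \<in> ?L"
      then obtain m where m: "m \<in> M" "subseq m w"
        using M(3) by blast
      have "set w \<subseteq> insert 0 {1..d}"
        using w L by fastforce
      moreover have "count_list w 0 = count_list m 0"
        using L_count w m(1) M(2) by (metis subsetD)
      ultimately have "w \<in> insertions {1..d} m"
        using m(2) by (intro in_insertionsI)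
      then show "w \<in> \<Union>(insertions {1..d} ` M)"
        using m(1) by blast
    next
      fix w assume "w \<in> \<Union>(insertions {1..d} ` M)"
      then obtain m where m: "m \<in> M" "w \<in> insertions {1..d} m"
        by blast
      then have mL: "m \<in> ?L"
        using M(2) by blast
      have "set w \<subseteq> {1..d} \<union> set m" "set m \<subseteq> {0..d}"
        using insertions_lists[OF m(2)] mL L by auto
      then have "w \<in> lists {0..d}"
        by fastforce
      \<comment> \<open>Insertions from \<open>{1..d}\<close> add no zeros, so \<open>w\<close> has
        the right number of them to be the word of a morphism out of \<open>x\<close>.\<close>
      moreover have "count_list w 0 = card (fst x)"
        using insertions_count[OF m(2), of 0] L_count[OF mL] by simp
      ultimately obtain z f where z: "z \<in> Obj (OI d)" "f \<in> Hom (OI d) x z" "word x (z, f) = w"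
        using exists_word[OF x False] by blast
      obtain P where P: "P \<in> J" "m = class_word x P"
        using mL by blast
      let ?Q = "morphism_class (OI d) x z f"
      have Q: "?Q \<in> morphism_classes (OI d) x" "class_word x ?Q = w"
        using z x by (simp_all add: morphism_class_in_classes class_word_morphism_class)
      have "morphism_le (OI d) x P ?Q"
        using x JC P insertions_subseq[OF m(2)] Q by (intro morphism_le_OI) auto
      then have "?Q \<in> J"
        using J P(1) Q(1) unfolding morphism_ideal_def by blast
      then show "w \<in> ?L"
        using Q(2) by blast
    qed
    also have "\<dots> \<in> ordered_languages {0..d}"
    proof (rule ordered_languages.union)
      show "finite (insertions {1..d} ` M)"
        using M(1) by simp
      fix K assume "K \<in> insertions {1..d} ` M"
      then obtain m where "m \<in> M" "K = insertions {1..d} m"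
        by blast
      then show "K \<in> ordered_languages {0..d}"
        using M(2) L by (auto intro!: insertions_ordered)
    qed
    finally show ?thesis .
  qed
qed

theorem theorem7p1p2:
  fixes d :: nat
  assumes "d \<ge> 1"
  shows "o_lingual (OI d :: ('a set \<times> 'a rel, ('a \<Rightarrow> 'a) \<times> ('a \<Rightarrow> nat)) category)
           (\<lambda>S. card (fst S)) \<and>
         groebner (OI d :: ('a set \<times> 'a rel, ('a \<Rightarrow> 'a) \<times> ('a \<Rightarrow> nat)) category)"
proof
  let ?OI = "OI d :: ('a set \<times> 'a rel, ('a \<Rightarrow> 'a) \<times> ('a \<Rightarrow> nat)) category"
  show "groebner ?OI"
    unfolding groebner_def
    by (intro conjI ballI directed_category_OI admissible_order_OI noetherian_morphisms_OI)
  \<comment> \<open>The witnesses for lingualness are the alphabet \<open>{0..d}\<close> and the map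
    \<open>class_word x\<close>.\<close>
  have words: "finite {0..d} \<and> class_word x ` morphism_classes ?OI x \<subseteq> lists {0..d} \<and>
      inj_on (class_word x) (morphism_classes ?OI x) \<and>
      (\<forall>y\<in>Obj ?OI. \<forall>f\<in>Hom ?OI x y. length (class_word x (morphism_class ?OI x y f)) = card (fst y)) \<and>
      (\<forall>J. morphism_ideal ?OI x J \<longrightarrow> class_word x ` J \<in> ordered_languages {0..d})"
    if x: "x \<in> Obj ?OI" for x
  proof (intro conjI ballI allI impI)
    show "class_word x ` morphism_classes ?OI x \<subseteq> lists {0..d}"
      using class_word_lists(1)[OF x] by blast
    show "inj_on (class_word x) (morphism_classes ?OI x)"
      using inj_on_class_word[OF x] .
    show "length (class_word x (morphism_class ?OI x y f)) = card (fst y)"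
      if "y \<in> Obj ?OI" "f \<in> Hom ?OI x y" for y f
      using that by (simp add: class_word_morphism_class[OF x] length_word)
    show "class_word x ` J \<in> ordered_languages {0..d}" if "morphism_ideal ?OI x J" for J
      using ideal_language_ordered[OF x that] .
  qed simp
  show "o_lingual ?OI (\<lambda>S. card (fst S))"
    unfolding o_lingual_def
  proof (intro conjI ballI directed_category_OI category_norm_OI)
    fix x assume x: "x \<in> Obj ?OI"
    show "\<exists>(\<Sigma> :: nat set) i. finite \<Sigma> \<and> i ` morphism_classes ?OI x \<subseteq> lists \<Sigma> \<and>
        inj_on i (morphism_classes ?OI x) \<and>
        (\<forall>y\<in>Obj ?OI. \<forall>f\<in>Hom ?OI x y. length (i (morphism_class ?OI x y f)) = card (fst y)) \<and>
        (\<forall>J. morphism_ideal ?OI x J \<longrightarrow> i ` J \<in> ordered_languages \<Sigma>)"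
      by (rule exI, rule exI, rule words[OF x])
  qed
qed

end
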